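(* Let $U$ be a steady self-similar entropy solution, without stagnation points, of the two-dimensional full Euler equations for a polytropic gas with exponent $\gamma>1$ (values in $\mathcal P_K$). (1) Suppose $I_i=[\theta_i,\theta_{i+1}]$ is a forward sector and $U$ is continuous on an open interval $B\subset\,]\overline\theta_i,\theta_{i+1}[$. Then either $U$ is constant on $B$, or $U$ is constant on either side of a single forward compression wave, i.e. there is a forward compression wave $[\alpha,\beta]$ meeting $B$ such that $U$ is constant on each of the (possibly empty) sets $\{\theta\in B:\theta<\alpha\}$ and $\{\theta\in B:\theta>\beta\}$. (2) Suppose $I_i=[\theta_i,\theta_{i+1}]$ is a backward sector and $U$ is continuous on an open interval $B\subset\,]\theta_i,\overline\theta_i[$. Then either $U$ is constant on $B$, or, in the same sense, $U$ is constant on either side of a single backward compression wave.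
   Context: Notation: $\rho$ density, $\vec u=(u,v)$ velocity, $p$ pressure, $e$ specific internal energy, $S$ specific entropy, $E=\rho\left(\frac{u^2+v^2}{2}+e\right)$, $U=(\rho,\rho u,\rho v,E)^T$. Polytropic gas: $e=\frac{p}{(\gamma-1)\rho}$, sound speed $c=\sqrt{\gamma p/\rho}$, $S=c_v\ln(p\rho^{-\gamma})+\text{const}$, $c_v>0$. Phase space: for a constant $K>1$, $\mathcal P_K$ is the set of $U$ with $K^{-1}\le\rho\le K$, $K^{-1}\le e\le K$, $|U|\le K$. Fluxes: $f^x(U)=(\rho u,\rho u^2+p,\rho uv,u(E+p))^T$, $f^y(U)=(\rho v,\rho uv,\rho v^2+p,v(E+p))^T$, $\psi^x=\rho uS$, $\psi^y=\rho vS$. A steady self-similar entropy solution is a $2\pi$-periodic function $\theta\mapsto U(\theta)\in\mathcal P_K$ in $L^\infty$ ($\theta$ is the polar angle), in a version such that for all $\theta_1<\theta_2$ $$(\sin\theta f^x(U)-\cos\theta f^y(U))\big|_{\theta_1}^{\theta_2}=\int_{\theta_1}^{\theta_2}\cos\eta f^x(U(\eta))+\sin\eta f^y(U(\eta))\,d\eta,$$ $$(\sin\theta\psi^x(U)-\cos\theta\psi^y(U))\big|_{\theta_1}^{\theta_2}\le\int_{\theta_1}^{\theta_2}\cos\eta\psi^x(U(\eta))+\sin\eta\psi^y(U(\eta))\,d\eta.$$ No stagnation points means $\vec u(\theta)\ne0$ for every $\theta$; then $U$ has one-sided limits at every discontinuity and is normalised to be right-continuous. Normal and tangential velocities: $N=u\sin\theta-v\cos\theta$,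 $L=u\cos\theta+v\sin\theta$. Sectors: the set $\{\theta\in[0,2\pi[:N(\theta)=0\}$ is finite; write it as $\theta_1<\dots<\theta_m$ and $\theta_{m+1}=\theta_1$ (mod $2\pi$, i.e. $\theta_1+2\pi$). The sectors are $I_i=[\theta_i,\theta_{i+1}]$; $I_i$ is forward if $N\ge0$ on $I_i$ and backward if $N\le0$ on $I_i$ (each sector is one or the other, with $N\neq0$ in its interior). In each sector, $\overline\theta_i$ denotes the unique point of $]\theta_i,\theta_{i+1}[$ with $L(\overline\theta_i)=0$ (it exists; $L$ is strictly monotone on $]\theta_i,\theta_{i+1}[$, decreasing in a forward sector and increasing in a backward one). Waves: a forward (resp. backward) Prandtl–Meyer wave is a closed interval $[\alpha,\beta]$, $\alpha<\beta$, with $N(\theta)=c(\theta)$ (resp. $N(\theta)=-c(\theta)$) for all $\theta\in[\alpha,\beta]$. In sector $I_i$ it is a forward compression wave if $\overline\theta_i\le\alpha<\beta$, $N=c$ and $L\le0$ on $[\alpha,\beta]$; a backward compression wave if $\alpha<\beta\le\overline\theta_i$, $N=-c$ and $L\le0$ on $[\alpha,\beta]$. *)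

theory Defs
  imports "HOL-Analysis.Analysis"
begin

lemma vector_4 [simp]:
  "(vector [w, x, y, z] :: ('a::zero)^4) $ 1 = w"
  "(vector [w, x, y, z] :: ('a::zero)^4) $ 2 = x"
  "(vector [w, x, y, z] :: ('a::zero)^4) $ 3 = y"
  "(vector [w, x, y, z] :: ('a::zero)^4) $ 4 = z"
  unfolding vector_def by simp_all

text \<open>
  A state is the vector of conserved quantities $(\rho, \rho u, \rho v, E)$; the other
  quantities are functions of it. They are meaningful where the density is nonzero,
  which holds throughout \<open>phase_space\<close> below.
\<close>

type_synonym state = "real^4"

definition density :: "state \<Rightarrow> real" where
  "density W = W $ 1"

definition vel_x :: "state \<Rightarrow> real" where
  "vel_x W = W $ 2 / W $ 1"

definition vel_y :: "state \<Rightarrow> real" where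
  "vel_y W = W $ 3 / W $ 1"

definition energy :: "state \<Rightarrow> real" where
  "energy W = W $ 4"

text \<open>Specific internal energy, solved from $E = \rho ((u^2 + v^2) / 2 + e)$.\<close>

definition int_energy :: "state \<Rightarrow> real" where
  "int_energy W = energy W / density W - ((vel_x W)\<^sup>2 + (vel_y W)\<^sup>2) / 2"

text \<open>Polytropic pressure law, solved from $e = p / ((\gamma - 1) \rho)$.\<close>

definition pressure :: "real \<Rightarrow> state \<Rightarrow> real" where
  "pressure \<gamma> W = (\<gamma> - 1) * density W * int_energy W"

definition sound_speed :: "real \<Rightarrow> state \<Rightarrow> real" where
  "sound_speed \<gamma> W = sqrt (\<gamma> * pressure \<gamma> W / density W)"

text \<open>The last parameter \<open>S0\<close> is the arbitrary additive constant of the entropy.\<close>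

definition entropy :: "real \<Rightarrow> real \<Rightarrow> real \<Rightarrow> state \<Rightarrow> real" where
  "entropy \<gamma> cv S0 W = cv * ln (pressure \<gamma> W * density W powr (- \<gamma>)) + S0"

lemma primitive_variables:
  assumes "\<rho> \<noteq> 0" and "\<gamma> \<noteq> 1"
    and "e = p / ((\<gamma> - 1) * \<rho>)"
    and "W = vector [\<rho>, \<rho> * u, \<rho> * v, \<rho> * ((u\<^sup>2 + v\<^sup>2) / 2 + e)]"
  shows "density W = \<rho>" "vel_x W = u" "vel_y W = v" "int_energy W = e" "pressure \<gamma> W = p"
  using assms
  by (simp_all add: density_def vel_x_def vel_y_def energy_def int_energy_def pressure_def)

definition phase_space :: "real \<Rightarrow> state set" where
  "phase_space K =
     {W. inverse K \<le> density W \<and> density W \<le> K \<and>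
         inverse K \<le> int_energy W \<and> int_energy W \<le> K \<and> norm W \<le> K}"

definition flux_x :: "real \<Rightarrow> state \<Rightarrow> state" where
  "flux_x \<gamma> W = vector
     [density W * vel_x W,
      density W * (vel_x W)\<^sup>2 + pressure \<gamma> W,
      density W * vel_x W * vel_y W,
      vel_x W * (energy W + pressure \<gamma> W)]"

definition flux_y :: "real \<Rightarrow> state \<Rightarrow> state" where
  "flux_y \<gamma> W = vector
     [density W * vel_y W,
      density W * vel_x W * vel_y W,
      density W * (vel_y W)\<^sup>2 + pressure \<gamma> W,
      vel_y W * (energy W + pressure \<gamma> W)]"

definition entropy_flux_x :: "real \<Rightarrow> real \<Rightarrow> real \<Rightarrow> state \<Rightarrow> real" where
  "entropy_flux_x \<gamma> cv S0 W = density W * vel_x W * entropy \<gamma> cv S0 W"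

definition entropy_flux_y :: "real \<Rightarrow> real \<Rightarrow> real \<Rightarrow> state \<Rightarrow> real" where
  "entropy_flux_y \<gamma> cv S0 W = density W * vel_y W * entropy \<gamma> cv S0 W"

text \<open>
  Membership in $L^\infty$ is measurability together with the bounds built into
  \<open>phase_space\<close>; the balance laws are imposed for every pair of angles, which selects
  the version of the function.
\<close>

definition steady_self_similar_entropy_solution ::
  "real \<Rightarrow> real \<Rightarrow> real \<Rightarrow> real \<Rightarrow> (real \<Rightarrow> state) \<Rightarrow> bool" where
  "steady_self_similar_entropy_solution \<gamma> cv S0 K U \<longleftrightarrow>
     (\<forall>t. U (t + 2 * pi) = U t) \<and>
     U \<in> borel_measurable lebesgue \<and>
     (\<forall>t. U t \<in> phase_space K) \<and>
     (\<forall>a b. a < b \<longrightarrow>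
        (sin b *\<^sub>R flux_x \<gamma> (U b) - cos b *\<^sub>R flux_y \<gamma> (U b))
        - (sin a *\<^sub>R flux_x \<gamma> (U a) - cos a *\<^sub>R flux_y \<gamma> (U a))
        = (LINT t:{a..b}|lebesgue.
             cos t *\<^sub>R flux_x \<gamma> (U t) + sin t *\<^sub>R flux_y \<gamma> (U t))) \<and>
     (\<forall>a b. a < b \<longrightarrow>
        (sin b * entropy_flux_x \<gamma> cv S0 (U b) - cos b * entropy_flux_y \<gamma> cv S0 (U b))
        - (sin a * entropy_flux_x \<gamma> cv S0 (U a) - cos a * entropy_flux_y \<gamma> cv S0 (U a))
        \<le> (LINT t:{a..b}|lebesgue.
             cos t * entropy_flux_x \<gamma> cv S0 (U t) + sin t * entropy_flux_y \<gamma> cv S0 (U t)))"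

definition no_stagnation_points :: "(real \<Rightarrow> state) \<Rightarrow> bool" where
  "no_stagnation_points U \<longleftrightarrow> (\<forall>t. (vel_x (U t), vel_y (U t)) \<noteq> (0, 0))"

definition right_continuous :: "(real \<Rightarrow> state) \<Rightarrow> bool" where
  "right_continuous U \<longleftrightarrow> (\<forall>t. continuous (at_right t) U)"

definition normal_vel :: "(real \<Rightarrow> state) \<Rightarrow> real \<Rightarrow> real" where
  "normal_vel U t = vel_x (U t) * sin t - vel_y (U t) * cos t"

definition tangential_vel :: "(real \<Rightarrow> state) \<Rightarrow> real \<Rightarrow> real" where
  "tangential_vel U t = vel_x (U t) * cos t + vel_y (U t) * sin t"

text \<open>
  \<open>\<theta> 1 < \<dots> < \<theta> m\<close> enumerate the zeros of the normal velocity in $[0, 2\pi[$, and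
  \<open>\<theta> (m + 1)\<close> closes up the circle. The \<open>i\<close>-th sector, for \<open>i \<in> {1..m}\<close>, is then
  \<open>{\<theta> i..\<theta> (i + 1)}\<close>.
\<close>

definition sector_endpoints :: "(real \<Rightarrow> state) \<Rightarrow> nat \<Rightarrow> (nat \<Rightarrow> real) \<Rightarrow> bool" where
  "sector_endpoints U m \<theta> \<longleftrightarrow>
     strict_mono_on {1..m} \<theta> \<and>
     \<theta> ` {1..m} = {t \<in> {0..<2 * pi}. normal_vel U t = 0} \<and>
     \<theta> (m + 1) = \<theta> 1 + 2 * pi"

definition forward_sector :: "(real \<Rightarrow> state) \<Rightarrow> real \<Rightarrow> real \<Rightarrow> bool" where
  "forward_sector U l r \<longleftrightarrow> (\<forall>t\<in>{l..r}. 0 \<le> normal_vel U t)"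

definition backward_sector :: "(real \<Rightarrow> state) \<Rightarrow> real \<Rightarrow> real \<Rightarrow> bool" where
  "backward_sector U l r \<longleftrightarrow> (\<forall>t\<in>{l..r}. normal_vel U t \<le> 0)"

definition forward_Prandtl_Meyer_wave ::
  "real \<Rightarrow> (real \<Rightarrow> state) \<Rightarrow> real \<Rightarrow> real \<Rightarrow> bool" where
  "forward_Prandtl_Meyer_wave \<gamma> U \<alpha> \<beta> \<longleftrightarrow>
     \<alpha> < \<beta> \<and> (\<forall>t\<in>{\<alpha>..\<beta>}. normal_vel U t = sound_speed \<gamma> (U t))"

definition backward_Prandtl_Meyer_wave ::
  "real \<Rightarrow> (real \<Rightarrow> state) \<Rightarrow> real \<Rightarrow> real \<Rightarrow> bool" where
  "backward_Prandtl_Meyer_wave \<gamma> U \<alpha> \<beta> \<longleftrightarrow>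
     \<alpha> < \<beta> \<and> (\<forall>t\<in>{\<alpha>..\<beta>}. normal_vel U t = - sound_speed \<gamma> (U t))"

text \<open>
  Compression waves contained in the sector \<open>{l..r}\<close>; \<open>tb\<close> is the zero of the
  tangential velocity in its interior.
\<close>

definition forward_compression_wave ::
  "real \<Rightarrow> (real \<Rightarrow> state) \<Rightarrow> real \<Rightarrow> real \<Rightarrow> real \<Rightarrow> real \<Rightarrow> real \<Rightarrow> bool" where
  "forward_compression_wave \<gamma> U l r tb \<alpha> \<beta> \<longleftrightarrow>
     {\<alpha>..\<beta>} \<subseteq> {l..r} \<and> tb \<le> \<alpha> \<and>
     forward_Prandtl_Meyer_wave \<gamma> U \<alpha> \<beta> \<and>
     (\<forall>t\<in>{\<alpha>..\<beta>}. tangential_vel U t \<le> 0)"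

definition backward_compression_wave ::
  "real \<Rightarrow> (real \<Rightarrow> state) \<Rightarrow> real \<Rightarrow> real \<Rightarrow> real \<Rightarrow> real \<Rightarrow> real \<Rightarrow> bool" where
  "backward_compression_wave \<gamma> U l r tb \<alpha> \<beta> \<longleftrightarrow>
     {\<alpha>..\<beta>} \<subseteq> {l..r} \<and> \<beta> \<le> tb \<and>
     backward_Prandtl_Meyer_wave \<gamma> U \<alpha> \<beta> \<and>
     (\<forall>t\<in>{\<alpha>..\<beta>}. tangential_vel U t \<le> 0)"

end

theory Submission
  imports Defs
begin

text \<open>
  In polar coordinates the balance laws read
  $(\rho N)' = \rho L$, $(\rho N L)' = \rho (L^2 - N^2)$, $(\rho N^2 + p)' = 2 \rho N L$ and
  $(\rho N H)' = \rho L H$, where $H$ is the total enthalpy; the four differentiated quantities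
  are continuous functions of the angle, even across shocks. Inside a sector $N \neq 0$, so the first two laws
  give $L' = - N$, and $L$ is strictly monotone between shocks and through them. This makes $L$ negative on
  the part of the sector that the theorem is about (\<open>tangential_vel_strict_mono\<close>).

  Where $U$ is continuous and $N^2 \neq c^2$, the remaining laws determine all derivatives: $N' = L$ and
  $\rho' = p' = 0$ (\<open>derivatives_off_sonic\<close>), which says that the Cartesian velocity, and with
  it $U$, is locally constant. Only sonic angles, those with $N^2 = c^2$, can carry a variation of $U$.

  Two sonic angles in $B$ cannot be separated by a gap: $U$ and $c$ would be constant on the gap, so
  $N^2$ would agree at its two ends, whereas $(N^2)' = 2 N L$ has no zero there (\<open>sonic_convex\<close>). Hence
  the sonic angles in $B$ form an interval, on both sides of which $U$ is constant. If this interval has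
  at most one point, $U$ is constant on $B$; otherwise its closure is the compression wave.

  The closure can contain an end of $B$ at which $U$ may jump. The set of sonic angles is nevertheless closed
  in the whole line (\<open>closed_sonic\<close>): $\rho N^2$ is a root of a quadratic
  equation whose coefficients are built from the four continuous fluxes, and an angle is sonic exactly when
  the discriminant vanishes. Thus no shock can have a sonic state on one side.
\<close>

section \<open>Calculus on an interval\<close>

lemma continuous_on_of_increments:
  fixes F f :: "real \<Rightarrow> real"
  assumes int: "\<And>a b. set_integrable lebesgue {a..b} f"
    and inc: "\<And>a b. a < b \<Longrightarrow> F b - F a = (LINT t:{a..b}|lebesgue. f t)"
  shows "continuous_on UNIV F"
proof -
  have "isCont F t" for t
  proof -
    have io: "f integrable_on {t-1..t+1}"
      using set_lebesgue_integral_eq_integral(1)[OF int] .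
    have eq: "F s = F (t-1) + integral {t-1..s} f" if "s \<in> {t-1..t+1}" for s
    proof (cases "s = t - 1")
      case False
      then show ?thesis
        using inc[of "t-1" s] that set_lebesgue_integral_eq_integral(2)[OF int, of "t-1" s] by auto
    qed simp
    have "continuous_on {t-1..t+1} (\<lambda>s. F (t-1) + integral {t-1..s} f)"
      by (intro continuous_intros indefinite_integral_continuous_1 io)
    then have "continuous_on {t-1..t+1} F"
      by (rule continuous_on_eq) (rule eq[symmetric])
    then show ?thesis
      by (rule continuous_on_interior) simp
  qed
  then show ?thesis
    by (simp add: continuous_at_imp_continuous_on)
qed

text \<open>
  The fundamental theorem of calculus on an arbitrary interval containing the base point: an interval to
  its right yields right derivatives of the balance laws even at a jump of a right-continuous solution,
  an open interval yields ordinary derivatives where the solution is continuous.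
\<close>

lemma has_real_derivative_of_increments:
  fixes F f :: "real \<Rightarrow> real"
  assumes int: "\<And>a b. set_integrable lebesgue {a..b} f"
    and inc: "\<And>a b. a < b \<Longrightarrow> F b - F a = (LINT t:{a..b}|lebesgue. f t)"
    and "convex T" and "t \<in> T" and cont: "continuous (at t within T) f"
  shows "(F has_real_derivative f t) (at t within T)"
proof -
  have close: "\<bar>F b - F a - f t * (b - a)\<bar> \<le> e * (b - a)"
    if "a < b" "\<And>s. s \<in> {a..b} \<Longrightarrow> \<bar>f s - f t\<bar> \<le> e" for a b e
  proof -
    have "0 \<le> e"
      using that(2)[of a] \<open>a < b\<close> by force
    have "(f has_integral (F b - F a)) {a..b}"
      using inc[OF \<open>a < b\<close>] has_integral_set_lebesgue[OF int[of a b]] by simp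
    moreover have "((\<lambda>s. f t) has_integral f t * (b - a)) {a..b}"
      using has_integral_const_real[of "f t" a b] \<open>a < b\<close> by (simp add: mult.commute)
    ultimately have "((\<lambda>s. f s - f t) has_integral (F b - F a - f t * (b - a))) {a..b}"
      by (rule has_integral_diff)
    from has_integral_bound_real[OF \<open>0 \<le> e\<close> _ this, of "{}"] that show ?thesis
      by simp
  qed
  show ?thesis
    unfolding has_field_derivative_def has_derivative_within_alt
  proof (intro conjI allI impI)
    show "bounded_linear ((*) (f t))"
      by (rule bounded_linear_mult_right)
    fix e :: real
    assume "0 < e"
    then obtain d where "d > 0" and d: "\<And>s. s \<in> T \<Longrightarrow> dist s t < d \<Longrightarrow> dist (f s) (f t) < e"
      using cont unfolding continuous_within_eps_delta by blast
    have "norm (F s - F t - f t * (s - t)) \<le> e * norm (s - t)" if "s \<in> T" "norm (s - t) < d" for s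
    proof -
      have near: "\<bar>f r - f t\<bar> \<le> e" if r: "r \<in> closed_segment s t" for r
      proof -
        have "r \<in> T"
          using r \<open>convex T\<close> \<open>s \<in> T\<close> \<open>t \<in> T\<close> closed_segment_subset by blast
        moreover have "dist r t < d"
          using r \<open>norm (s - t) < d\<close>
          by (auto simp: closed_segment_eq_real_ivl dist_real_def split: if_splits)
        ultimately show ?thesis
          using d[of r] by (simp add: dist_real_def)
      qed
      consider "s < t" | "s = t" | "t < s"
        by linarith
      then show ?thesis
      proof cases
        case 1
        then have "\<bar>F t - F s - f t * (t - s)\<bar> \<le> e * (t - s)"
          using near by (intro close) (auto simp: closed_segment_eq_real_ivl)
        moreover have "F t - F s - f t * (t - s) = - (F s - F t - f t * (s - t))"
          by (simp add: algebra_simps)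
        ultimately show ?thesis
          using 1 by simp
      next
        case 3
        then have "\<bar>F s - F t - f t * (s - t)\<bar> \<le> e * (s - t)"
          using near by (intro close) (auto simp: closed_segment_eq_real_ivl)
        then show ?thesis
          using 3 by simp
      qed simp
    qed
    with \<open>d > 0\<close> show "\<exists>d>0. \<forall>y\<in>T. norm (y - t) < d \<longrightarrow> norm (F y - F t - f t * (y - t)) \<le> e * norm (y - t)"
      by blast
  qed
qed

text \<open>
  A minimum over \<open>{a..b}\<close> cannot be attained to the left of \<open>b\<close>, as the function decreases there.
\<close>

lemma right_derivative_neg_imp_less:
  fixes f :: "real \<Rightarrow> real"
  assumes "a < b" and cont: "continuous_on {a..b} f"
    and deriv: "\<And>t. t \<in> {a..<b} \<Longrightarrow> \<exists>d<0. (f has_real_derivative d) (at t within {t..b})"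
  shows "f b < f a"
proof -
  have not_min: "\<exists>s\<in>{a..b}. f s < f t" if t: "t \<in> {a..<b}" for t
  proof -
    obtain d where "d < 0" "(f has_real_derivative d) (at t within {t..b})"
      using deriv[OF t] by blast
    from has_real_derivative_neg_dec_right[OF this(2,1)]
    obtain e where "e > 0" and e: "\<And>h. h > 0 \<Longrightarrow> h < e \<Longrightarrow> t + h \<le> b \<Longrightarrow> f (t + h) < f t"
      by auto
    define h where "h = min (e / 2) (b - t)"
    have "0 < h" "h < e" "t + h \<in> {a..b}"
      using t \<open>e > 0\<close> by (auto simp: h_def)
    with e[of h] show ?thesis
      by auto
  qed
  obtain x where x: "x \<in> {a..b}" "\<And>s. s \<in> {a..b} \<Longrightarrow> f x \<le> f s"
    using continuous_attains_inf[of "{a..b}" f] cont \<open>a < b\<close> by auto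
  then have "x = b"
    using not_min[of x] by force
  moreover obtain s where "s \<in> {a..b}" "f s < f a"
    using not_min[of a] \<open>a < b\<close> by auto
  ultimately show ?thesis
    using x(2)[of s] by simp
qed

text \<open>
  Near \<open>t\<close> the sign of \<open>w\<close> does not change, so \<open>w\<close> is a fixed sign times the root of its square.
\<close>

lemma has_real_derivative_of_square:
  fixes w :: "real \<Rightarrow> real"
  assumes cont: "isCont w t" and "w t \<noteq> 0"
    and deriv: "((\<lambda>x. (w x)\<^sup>2) has_real_derivative d) (at t)"
  shows "(w has_real_derivative d / (2 * w t)) (at t)"
proof -
  have lim: "(w \<longlongrightarrow> w t) (nhds t)"
    using cont by (simp add: isCont_def tendsto_at_iff_tendsto_nhds)
  have "eventually (\<lambda>x. sgn (w x) = sgn (w t)) (nhds t)"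
  proof (cases "w t > 0")
    case True
    from order_tendstoD(1)[OF lim this] show ?thesis
      by eventually_elim (use True in simp)
  next
    case False
    with \<open>w t \<noteq> 0\<close> have "w t < 0"
      by simp
    from order_tendstoD(2)[OF lim this] show ?thesis
      by eventually_elim (use \<open>w t < 0\<close> in simp)
  qed
  then have ev: "eventually (\<lambda>x. sgn (w t) * sqrt ((w x)\<^sup>2) = w x) (nhds t)"
    by eventually_elim (metis real_sqrt_abs sgn_mult_abs)
  have "((\<lambda>x. sgn (w t) * sqrt ((w x)\<^sup>2)) has_real_derivative
          sgn (w t) * (inverse (sqrt ((w t)\<^sup>2)) / 2 * d)) (at t)"
    using \<open>w t \<noteq> 0\<close>
    by (intro DERIV_cmult DERIV_chain2[OF DERIV_real_sqrt deriv]) simp_all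
  moreover have "sgn (w t) * (inverse (sqrt ((w t)\<^sup>2)) / 2 * d) = d / (2 * w t)"
    using \<open>w t \<noteq> 0\<close> by (cases "w t > 0") (simp_all add: field_simps)
  ultimately have "((\<lambda>x. sgn (w t) * sqrt ((w x)\<^sup>2)) has_real_derivative d / (2 * w t)) (at t)"
    by (simp only:)
  then show ?thesis
    by (rule DERIV_cong_ev[OF refl ev refl, THEN iffD1])
qed

section \<open>Balance laws in polar coordinates\<close>

definition enthalpy :: "real \<Rightarrow> state \<Rightarrow> real" where
  "enthalpy \<gamma> W = (energy W + pressure \<gamma> W) / density W"

text \<open>
  The normal direction is clockwise: \<open>N > 0\<close> is flow against increasing angle.
\<close>

locale self_similar_flow =
  fixes \<gamma> K :: real and U :: "real \<Rightarrow> state"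
  assumes gamma: "\<gamma> > 1" and K: "K > 1"
    and measurable: "U \<in> borel_measurable lebesgue"
    and in_phase_space: "U t \<in> phase_space K"
    and balance: "a < b \<Longrightarrow>
        (sin b *\<^sub>R flux_x \<gamma> (U b) - cos b *\<^sub>R flux_y \<gamma> (U b))
        - (sin a *\<^sub>R flux_x \<gamma> (U a) - cos a *\<^sub>R flux_y \<gamma> (U a))
        = (LINT t:{a..b}|lebesgue.
             cos t *\<^sub>R flux_x \<gamma> (U t) + sin t *\<^sub>R flux_y \<gamma> (U t))"
begin

abbreviation "\<rho> t \<equiv> density (U t)"
abbreviation "p t \<equiv> pressure \<gamma> (U t)"
abbreviation "N \<equiv> normal_vel U"
abbreviation "L \<equiv> tangential_vel U"
abbreviation "H t \<equiv> enthalpy \<gamma> (U t)"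

lemma density_pos: "\<rho> t > 0" and pressure_pos: "p t > 0"
proof -
  have "inverse K > 0"
    using K by simp
  moreover have "inverse K \<le> \<rho> t" "inverse K \<le> int_energy (U t)"
    using in_phase_space[of t] unfolding phase_space_def by blast+
  ultimately have "\<rho> t > 0" "int_energy (U t) > 0"
    by linarith+
  then show "\<rho> t > 0" "p t > 0"
    using gamma by (simp_all add: pressure_def)
qed

lemma vel_x_eq: "vel_x (U t) = N t * sin t + L t * cos t"
  and vel_y_eq: "vel_y (U t) = L t * sin t - N t * cos t"
proof -
  have "N t * sin t + L t * cos t = vel_x (U t) * ((sin t)\<^sup>2 + (cos t)\<^sup>2)"
       "L t * sin t - N t * cos t = vel_y (U t) * ((sin t)\<^sup>2 + (cos t)\<^sup>2)"
    unfolding normal_vel_def tangential_vel_def by algebra+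
  then show "vel_x (U t) = N t * sin t + L t * cos t" "vel_y (U t) = L t * sin t - N t * cos t"
    by simp_all
qed

lemma enthalpy_eq: "H t = ((N t)\<^sup>2 + (L t)\<^sup>2) / 2 + \<gamma> / (\<gamma> - 1) * (p t / \<rho> t)"
proof -
  have "(N t)\<^sup>2 + (L t)\<^sup>2 = ((vel_x (U t))\<^sup>2 + (vel_y (U t))\<^sup>2) * ((sin t)\<^sup>2 + (cos t)\<^sup>2)"
    unfolding normal_vel_def tangential_vel_def by algebra
  then have "(N t)\<^sup>2 + (L t)\<^sup>2 = (vel_x (U t))\<^sup>2 + (vel_y (U t))\<^sup>2"
    by simp
  moreover have "energy (U t) / \<rho> t = int_energy (U t) + ((vel_x (U t))\<^sup>2 + (vel_y (U t))\<^sup>2) / 2"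
    by (simp add: int_energy_def)
  moreover have "int_energy (U t) + p t / \<rho> t = \<gamma> / (\<gamma> - 1) * (p t / \<rho> t)"
    using gamma density_pos[of t] by (simp add: pressure_def field_simps)
  ultimately show ?thesis
    by (simp add: enthalpy_def add_divide_distrib)
qed

text \<open>
  Here \<open>T\<close> stands for an interval to the right of \<open>t\<close> when only right-continuity is known, and for an
  open interval on which \<open>U\<close> is continuous.
\<close>

lemma continuous_primitive:
  assumes "continuous (at t within T) U"
  shows "continuous (at t within T) \<rho>" "continuous (at t within T) (\<lambda>s. vel_x (U s))"
    "continuous (at t within T) (\<lambda>s. vel_y (U s))" "continuous (at t within T) (\<lambda>s. energy (U s))"
    "continuous (at t within T) p" "continuous (at t within T) N" "continuous (at t within T) L"
proof -
  have nth: "continuous (at t within T) (\<lambda>s. U s $ k)" for k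
    using assms by (intro continuous_intros)
  have nz: "U t $ 1 \<noteq> 0"
    using density_pos[of t] by (simp add: density_def)
  show rho: "continuous (at t within T) \<rho>"
    and E: "continuous (at t within T) (\<lambda>s. energy (U s))"
    unfolding density_def energy_def by (rule nth)+
  show u: "continuous (at t within T) (\<lambda>s. vel_x (U s))"
    and v: "continuous (at t within T) (\<lambda>s. vel_y (U s))"
    unfolding vel_x_def vel_y_def by (intro continuous_at_within_divide nth nz)+
  show "continuous (at t within T) p"
    unfolding pressure_def int_energy_def
    using density_pos[of t]
    by (intro continuous_diff continuous_mult continuous_add continuous_power
        continuous_at_within_divide continuous_const rho u v E) auto
  have trig: "continuous (at t within T) sin" "continuous (at t within T) cos"
    by (rule continuous_at_imp_continuous_at_within, simp)+
  show "continuous (at t within T) N" "continuous (at t within T) L"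
    unfolding normal_vel_def[abs_def] tangential_vel_def[abs_def]
    by (intro continuous_add continuous_diff continuous_mult u v trig)+
qed

text \<open>
  \<open>U\<close> takes values in a compact set on which the density stays away from zero, so that every
  continuous function of the state is bounded along \<open>U\<close>.
\<close>

lemma set_integrable_continuous_of_state:
  fixes h :: "state \<Rightarrow> state" and g :: "real \<Rightarrow> real"
  assumes h: "continuous_on {W. W $ 1 \<noteq> 0} h" and g: "continuous_on UNIV g" and "bounded (range g)"
  shows "set_integrable lebesgue {a..b} (\<lambda>t. g t *\<^sub>R h (U t))"
proof -
  define C where "C = {W :: state. inverse K \<le> W $ 1} \<inter> cball 0 K"
  have UC: "U t \<in> C" for t
    using in_phase_space[of t] by (simp add: C_def phase_space_def density_def)
  have "closed {W :: state. inverse K \<le> W $ 1}"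
    by (intro closed_Collect_le continuous_intros)
  then have "compact C"
    unfolding C_def by (intro closed_Int_compact compact_cball)
  moreover have "C \<subseteq> {W. W $ 1 \<noteq> 0}"
    using K by (auto simp: C_def)
  then have hC: "continuous_on C h"
    using h continuous_on_subset by blast
  ultimately have "bounded (h ` C)"
    by (intro compact_imp_bounded compact_continuous_image)
  then obtain B where B: "\<And>t. norm (h (U t)) \<le> B"
    using UC unfolding bounded_iff by blast
  obtain G where G: "\<And>t. norm (g t) \<le> G"
    using \<open>bounded (range g)\<close> unfolding bounded_iff by blast
  have "h \<in> borel_measurable (restrict_space borel C)"
    by (rule borel_measurable_continuous_on_restrict[OF hC])
  moreover have "U \<in> measurable lebesgue (restrict_space borel C)"
    using measurable UC by (intro measurable_restrict_space2) auto
  ultimately have hU: "(\<lambda>t. h (U t)) \<in> borel_measurable lebesgue"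
    by (rule measurable_compose[rotated])
  have "g \<in> borel_measurable lebesgue"
    using borel_measurable_continuous_onI[OF g] by (simp add: measurable_completion)
  then have meas: "(\<lambda>t. g t *\<^sub>R h (U t)) \<in> borel_measurable lebesgue"
    using hU by (rule borel_measurable_scaleR)
  have "norm (g t *\<^sub>R h (U t)) \<le> G * B" for t
    unfolding norm_scaleR using B[of t] G[of t]
    by (intro mult_mono) (auto intro: order_trans[OF norm_ge_zero])
  then have "norm (indicat_real {a..b} t *\<^sub>R g t *\<^sub>R h (U t)) \<le> G * B" if "t \<in> {a..b}" for t
    using that by simp
  then show ?thesis
    unfolding set_integrable_def
    using meas borel_measurable_scaleR[OF borel_measurable_indicator meas, of "{a..b}"]
    by (intro integrableI_bounded_set[where A = "{a..b}" and B = "G * B"]) (auto simp: emeasure_lborel_Icc_eq simp del: scaleR_scaleR)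
qed

abbreviation "flux t \<equiv> sin t *\<^sub>R flux_x \<gamma> (U t) - cos t *\<^sub>R flux_y \<gamma> (U t)"
abbreviation "source t \<equiv> cos t *\<^sub>R flux_x \<gamma> (U t) + sin t *\<^sub>R flux_y \<gamma> (U t)"

lemma continuous_on_flux:
  "continuous_on {W. W $ 1 \<noteq> 0} (flux_x \<gamma>)" "continuous_on {W. W $ 1 \<noteq> 0} (flux_y \<gamma>)"
proof -
  have vec: "continuous_on A f" if "\<forall>k. continuous_on A (\<lambda>W. f W $ k)" for A and f :: "state \<Rightarrow> state"
    using that continuous_on_vec_lambda[of A "\<lambda>k W. f W $ k"] by simp
  have prim: "continuous_on {W. W $ 1 \<noteq> 0} density" "continuous_on {W. W $ 1 \<noteq> 0} vel_x"
    "continuous_on {W. W $ 1 \<noteq> 0} vel_y" "continuous_on {W. W $ 1 \<noteq> 0} energy"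
    unfolding density_def[abs_def] vel_x_def[abs_def] vel_y_def[abs_def] energy_def[abs_def]
    by (intro continuous_intros; simp)+
  have pr: "continuous_on {W. W $ 1 \<noteq> 0} (pressure \<gamma>)"
    unfolding pressure_def[abs_def] int_energy_def[abs_def]
    by (intro continuous_intros prim) (simp_all add: density_def)
  show "continuous_on {W. W $ 1 \<noteq> 0} (flux_x \<gamma>)"
    by (rule vec, simp add: forall_4 flux_x_def, intro conjI continuous_intros prim pr)
  show "continuous_on {W. W $ 1 \<noteq> 0} (flux_y \<gamma>)"
    by (rule vec, simp add: forall_4 flux_y_def, intro conjI continuous_intros prim pr)
qed

lemma set_integrable_source: "set_integrable lebesgue {a..b} source"
proof -
  have "bounded (range (cos :: real \<Rightarrow> real))" "bounded (range (sin :: real \<Rightarrow> real))"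
    by (auto simp: bounded_iff intro!: exI[of _ 1])
  then show ?thesis
    by (intro set_integral_add(1) set_integrable_continuous_of_state continuous_on_flux continuous_intros)
qed

lemma set_integrable_source_nth: "set_integrable lebesgue {a..b} (\<lambda>t. source t $ k)"
  using integrable_bounded_linear[OF bounded_linear_vec_nth set_integrable_source[of a b, unfolded set_integrable_def]]
  by (simp add: set_integrable_def)

lemma flux_nth_increment:
  assumes "a < b"
  shows "flux b $ k - flux a $ k = (LINT t:{a..b}|lebesgue. source t $ k)"
proof -
  have "flux b $ k - flux a $ k = (LINT t:{a..b}|lebesgue. source t) $ k"
    by (simp only: balance[OF assms, symmetric] vector_minus_component)
  also have "\<dots> = (LINT t:{a..b}|lebesgue. source t $ k)"
    unfolding set_lebesgue_integral_def
      integral_bounded_linear[OF bounded_linear_vec_nth set_integrable_source[unfolded set_integrable_def], symmetric]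
      vector_scaleR_component ..
  finally show ?thesis .
qed

lemma continuous_on_flux_nth: "continuous_on UNIV (\<lambda>t. flux t $ k)"
  by (rule continuous_on_of_increments[OF set_integrable_source_nth flux_nth_increment])

lemma flux_nth_has_derivative:
  assumes "convex T" "t \<in> T" and U: "continuous (at t within T) U"
  shows "((\<lambda>s. flux s $ k) has_real_derivative source t $ k) (at t within T)"
proof (rule has_real_derivative_of_increments[OF set_integrable_source_nth flux_nth_increment assms(1,2)])
  have "{W :: state. W $ 1 \<noteq> 0} = - {W. W $ 1 = 0}"
    by blast
  moreover have "closed {W :: state. W $ 1 = 0}"
    by (intro closed_Collect_eq continuous_intros)
  ultimately have "open {W :: state. W $ 1 \<noteq> 0}"
    by (simp add: open_Compl)
  then have iso: "isCont (flux_x \<gamma>) (U t)" "isCont (flux_y \<gamma>) (U t)"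
    using continuous_on_flux density_pos[of t]
    by (auto simp: continuous_on_eq_continuous_at density_def)
  have fl: "continuous (at t within T) (\<lambda>s. flux_x \<gamma> (U s) $ k)"
    "continuous (at t within T) (\<lambda>s. flux_y \<gamma> (U s) $ k)"
    using continuous_within_compose3[OF iso(1) U] continuous_within_compose3[OF iso(2) U]
    by (intro continuous_component; simp)+
  have trig: "continuous (at t within T) sin" "continuous (at t within T) cos"
    by (rule continuous_at_imp_continuous_at_within, simp)+
  show "continuous (at t within T) (\<lambda>s. source s $ k)"
    by (simp, intro continuous_add continuous_mult trig fl)
qed

text \<open>
  The momentum components are rotated into the tangential and the normal direction.
\<close>

lemma flux_nth_simps:
  "flux t $ 1 = \<rho> t * N t"
  "cos t * flux t $ 2 + sin t * flux t $ 3 = \<rho> t * N t * L t"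
  "sin t * flux t $ 2 - cos t * flux t $ 3 = \<rho> t * (N t)\<^sup>2 + p t"
  "flux t $ 4 = \<rho> t * N t * H t"
proof -
  show "flux t $ 1 = \<rho> t * N t"
    by (simp add: flux_x_def flux_y_def normal_vel_def algebra_simps)
  have "cos t * flux t $ 2 + sin t * flux t $ 3 = \<rho> t * N t * L t"
    by (simp add: flux_x_def flux_y_def normal_vel_def tangential_vel_def algebra_simps power2_eq_square)
  then show "cos t * flux t $ 2 + sin t * flux t $ 3 = \<rho> t * N t * L t" .
  have "sin t * flux t $ 2 - cos t * flux t $ 3 = \<rho> t * (N t)\<^sup>2 + p t * (sin t * sin t + cos t * cos t)"
    by (simp add: flux_x_def flux_y_def normal_vel_def algebra_simps power2_eq_square
        del: sin_cos_squared_add sin_cos_squared_add2 sin_cos_squared_add3)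
  then show "sin t * flux t $ 2 - cos t * flux t $ 3 = \<rho> t * (N t)\<^sup>2 + p t"
    by (simp flip: power2_eq_square)
  have "flux t $ 4 = N t * (energy (U t) + p t)"
    by (simp add: flux_x_def flux_y_def normal_vel_def algebra_simps)
  then show "flux t $ 4 = \<rho> t * N t * H t"
    using density_pos[of t] by (simp add: enthalpy_def)
qed

lemma source_nth_simps:
  "source t $ 1 = \<rho> t * L t"
  "source t $ 4 = \<rho> t * L t * H t"
  "cos t * source t $ 2 + sin t * source t $ 3 = \<rho> t * (L t)\<^sup>2 + p t"
  "sin t * source t $ 2 - cos t * source t $ 3 = \<rho> t * N t * L t"
proof -
  show "source t $ 1 = \<rho> t * L t"
    by (simp add: flux_x_def flux_y_def tangential_vel_def algebra_simps)
  have "source t $ 4 = L t * (energy (U t) + p t)"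
    by (simp add: flux_x_def flux_y_def tangential_vel_def algebra_simps)
  then show "source t $ 4 = \<rho> t * L t * H t"
    using density_pos[of t] by (simp add: enthalpy_def)
  have "cos t * source t $ 2 + sin t * source t $ 3 = \<rho> t * (L t)\<^sup>2 + p t * (sin t * sin t + cos t * cos t)"
    by (simp add: flux_x_def flux_y_def tangential_vel_def algebra_simps power2_eq_square
        del: sin_cos_squared_add sin_cos_squared_add2 sin_cos_squared_add3)
  then show "cos t * source t $ 2 + sin t * source t $ 3 = \<rho> t * (L t)\<^sup>2 + p t"
    by (simp flip: power2_eq_square)
  show "sin t * source t $ 2 - cos t * source t $ 3 = \<rho> t * N t * L t"
    by (simp add: flux_x_def flux_y_def tangential_vel_def normal_vel_def algebra_simps power2_eq_square)
qed

lemma continuous_on_fluxes: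
  "continuous_on UNIV (\<lambda>t. \<rho> t * N t)"
  "continuous_on UNIV (\<lambda>t. \<rho> t * N t * L t)"
  "continuous_on UNIV (\<lambda>t. \<rho> t * (N t)\<^sup>2 + p t)"
  "continuous_on UNIV (\<lambda>t. \<rho> t * N t * H t)"
proof -
  note flux = continuous_on_flux_nth[of 1] continuous_on_flux_nth[of 4]
  show "continuous_on UNIV (\<lambda>t. \<rho> t * N t)" "continuous_on UNIV (\<lambda>t. \<rho> t * N t * H t)"
    using flux by (simp_all only: flux_nth_simps)
  have "continuous_on UNIV (\<lambda>t. cos t * flux t $ 2 + sin t * flux t $ 3)"
    "continuous_on UNIV (\<lambda>t. sin t * flux t $ 2 - cos t * flux t $ 3)"
    by (intro continuous_on_add continuous_on_diff continuous_on_mult continuous_on_flux_nth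
        continuous_on_sin continuous_on_cos continuous_on_id)+
  then show "continuous_on UNIV (\<lambda>t. \<rho> t * N t * L t)"
    "continuous_on UNIV (\<lambda>t. \<rho> t * (N t)\<^sup>2 + p t)"
    unfolding flux_nth_simps .
qed

text \<open>
  The rotation depends on the angle. Its derivative contributes minus the normal flux to the tangential
  law, which cancels the pressure there, and the tangential flux to the normal law.
\<close>

lemma polar_balance_laws:
  assumes "convex T" "t \<in> T" "continuous (at t within T) U"
  shows mass_balance: "((\<lambda>s. \<rho> s * N s) has_real_derivative \<rho> t * L t) (at t within T)"
    and tangential_balance: "((\<lambda>s. \<rho> s * N s * L s) has_real_derivative \<rho> t * ((L t)\<^sup>2 - (N t)\<^sup>2)) (at t within T)"
    and normal_balance: "((\<lambda>s. \<rho> s * (N s)\<^sup>2 + p s) has_real_derivative 2 * \<rho> t * N t * L t) (at t within T)"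
    and energy_balance: "((\<lambda>s. \<rho> s * N s * H s) has_real_derivative \<rho> t * L t * H t) (at t within T)"
proof -
  note deriv = flux_nth_has_derivative[OF assms]
  note sin = DERIV_sin[THEN has_field_derivative_at_within, of t T]
  note cos = DERIV_cos[THEN has_field_derivative_at_within, of t T]
  show "((\<lambda>s. \<rho> s * N s) has_real_derivative \<rho> t * L t) (at t within T)"
    using deriv[of 1] by (simp only: flux_nth_simps source_nth_simps)
  show "((\<lambda>s. \<rho> s * N s * H s) has_real_derivative \<rho> t * L t * H t) (at t within T)"
    using deriv[of 4] by (simp only: flux_nth_simps source_nth_simps)
  have "((\<lambda>s. cos s * flux s $ 2 + sin s * flux s $ 3) has_real_derivative
      cos t * source t $ 2 + sin t * source t $ 3 - (sin t * flux t $ 2 - cos t * flux t $ 3)) (at t within T)"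
    by (rule DERIV_cong[OF DERIV_add[OF DERIV_mult[OF cos deriv] DERIV_mult[OF sin deriv]]]) algebra
  then show "((\<lambda>s. \<rho> s * N s * L s) has_real_derivative \<rho> t * ((L t)\<^sup>2 - (N t)\<^sup>2)) (at t within T)"
    unfolding flux_nth_simps source_nth_simps by (simp add: right_diff_distrib)
  have "((\<lambda>s. sin s * flux s $ 2 - cos s * flux s $ 3) has_real_derivative
      sin t * source t $ 2 - cos t * source t $ 3 + (cos t * flux t $ 2 + sin t * flux t $ 3)) (at t within T)"
    by (rule DERIV_cong[OF DERIV_diff[OF DERIV_mult[OF sin deriv] DERIV_mult[OF cos deriv]]]) algebra
  then show "((\<lambda>s. \<rho> s * (N s)\<^sup>2 + p s) has_real_derivative 2 * \<rho> t * N t * L t) (at t within T)"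
    unfolding flux_nth_simps source_nth_simps by (simp add: mult.assoc)
qed

text \<open>
  Here \<open>L\<close> is the quotient of the tangential momentum flux and the mass flux.
\<close>

lemma tangential_vel_has_derivative:
  assumes "convex T" "t \<in> T" "continuous (at t within T) U" and N: "\<And>s. s \<in> T \<Longrightarrow> N s \<noteq> 0"
  shows "(L has_real_derivative - N t) (at t within T)"
proof -
  have nz: "\<rho> t * N t \<noteq> 0"
    using N[OF \<open>t \<in> T\<close>] density_pos[of t] by simp
  have "((\<lambda>s. (\<rho> s * N s * L s) / (\<rho> s * N s)) has_real_derivative
      (\<rho> t * ((L t)\<^sup>2 - (N t)\<^sup>2) * (\<rho> t * N t) - \<rho> t * N t * L t * (\<rho> t * L t)) / ((\<rho> t * N t) * (\<rho> t * N t)))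
      (at t within T)"
    by (intro DERIV_divide tangential_balance mass_balance assms nz)
  also have "(\<rho> t * ((L t)\<^sup>2 - (N t)\<^sup>2) * (\<rho> t * N t) - \<rho> t * N t * L t * (\<rho> t * L t)) / ((\<rho> t * N t) * (\<rho> t * N t)) = - N t"
    using nz by (simp add: field_simps power2_eq_square)
  finally have deriv: "((\<lambda>s. (\<rho> s * N s * L s) / (\<rho> s * N s)) has_real_derivative - N t) (at t within T)" .
  have "\<rho> s * N s * L s / (\<rho> s * N s) = L s" if "s \<in> T" for s
    using N[OF that] density_pos[of s] by simp
  with deriv show ?thesis
    by (rule has_field_derivative_transform_within[OF _ zero_less_one \<open>t \<in> T\<close>])
qed

text \<open>
  As a quotient of two continuous fluxes, \<open>L\<close> is continuous even where \<open>U\<close> jumps, and a sign of its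
  right derivative at every angle suffices for monotonicity.
\<close>

lemma tangential_vel_strict_mono:
  assumes "x < y" and N: "\<And>t. t \<in> {x..y} \<Longrightarrow> N t \<noteq> 0" and right: "\<And>t. continuous (at_right t) U"
  shows "(\<forall>t\<in>{x..y}. N t > 0) \<Longrightarrow> L y < L x"
    and "(\<forall>t\<in>{x..y}. N t < 0) \<Longrightarrow> L x < L y"
proof -
  have "continuous_on {x..y} (\<lambda>s. (\<rho> s * N s * L s) / (\<rho> s * N s))"
    using N density_pos
    by (intro continuous_on_divide continuous_on_subset[OF continuous_on_fluxes(1)]
        continuous_on_subset[OF continuous_on_fluxes(2)]) (auto simp: less_imp_neq[symmetric])
  moreover have "\<rho> s * N s * L s / (\<rho> s * N s) = L s" if "s \<in> {x..y}" for s
    using N[OF that] density_pos[of s] by simp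
  ultimately have cont: "continuous_on {x..y} L"
    by (rule continuous_on_eq)
  have deriv: "(L has_real_derivative - N t) (at t within {t..y})" if "t \<in> {x..<y}" for t
    using that N right[of t] by (intro tangential_vel_has_derivative) (auto simp: at_within_Icc_at_right)
  show "L y < L x" if neg: "\<forall>t\<in>{x..y}. N t > 0"
  proof (rule right_derivative_neg_imp_less[OF \<open>x < y\<close> cont])
    show "\<exists>d<0. (L has_real_derivative d) (at t within {t..y})" if "t \<in> {x..<y}" for t
      using deriv[OF that] neg that by (intro exI[of _ "- N t"]) auto
  qed
  show "L x < L y" if pos: "\<forall>t\<in>{x..y}. N t < 0"
  proof -
    have "- L y < - L x"
    proof (rule right_derivative_neg_imp_less[OF \<open>x < y\<close> continuous_on_minus[OF cont]])
      show "\<exists>d<0. ((\<lambda>s. - L s) has_real_derivative d) (at t within {t..y})" if "t \<in> {x..<y}" for t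
        using DERIV_minus[OF deriv[OF that]] pos that by (intro exI[of _ "N t"]) auto
    qed
    then show ?thesis
      by simp
  qed
qed

section \<open>The sonic set\<close>

definition sonic :: "real set" where
  "sonic = {t. \<rho> t * (N t)\<^sup>2 = \<gamma> * p t}"

lemma sonic_iff: "t \<in> sonic \<longleftrightarrow> \<bar>N t\<bar> = sound_speed \<gamma> (U t)"
proof -
  have "t \<in> sonic \<longleftrightarrow> (N t)\<^sup>2 = \<gamma> * p t / \<rho> t"
    using density_pos[of t] by (simp add: sonic_def field_simps)
  also have "\<dots> \<longleftrightarrow> \<bar>N t\<bar> = sound_speed \<gamma> (U t)"
  proof -
    have "0 \<le> \<gamma> * p t / \<rho> t"
      using gamma density_pos[of t] pressure_pos[of t] by simp
    then have "(sound_speed \<gamma> (U t))\<^sup>2 = \<gamma> * p t / \<rho> t" "0 \<le> sound_speed \<gamma> (U t)"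
      by (simp_all add: sound_speed_def)
    then show ?thesis
      by (metis abs_of_nonneg power2_abs power2_eq_iff_nonneg abs_ge_zero)
  qed
  finally show ?thesis .
qed

text \<open>
  Write \<open>x = \<rho> N\<^sup>2\<close>, \<open>P = x + p\<close> and \<open>m = \<rho> N\<close>. Eliminating \<open>p\<close> from the formula for the enthalpy
  leaves the quadratic equation \<open>(\<gamma> + 1) x\<^sup>2 - 2 \<gamma> P x = (\<gamma> - 1) ((m L)\<^sup>2 - 2 m (m H))\<close>. Half the derivative of
  its left-hand side in \<open>x\<close> is \<open>x - \<gamma> p\<close>, whose square is therefore a quarter of the discriminant. The
  right-hand side below contains nothing but fluxes that are continuous across shocks.
\<close>

lemma sonic_discriminant:
  "(\<gamma> * p t - \<rho> t * (N t)\<^sup>2)\<^sup>2 =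
     \<gamma>\<^sup>2 * (\<rho> t * (N t)\<^sup>2 + p t)\<^sup>2
     + (\<gamma>\<^sup>2 - 1) * ((\<rho> t * N t * L t)\<^sup>2 - 2 * ((\<rho> t * N t) * (\<rho> t * N t * H t)))"
proof -
  have h: "2 * (\<gamma> - 1) * (\<rho> t * H t) = (\<gamma> - 1) * \<rho> t * ((N t)\<^sup>2 + (L t)\<^sup>2) + 2 * \<gamma> * p t"
    using gamma density_pos[of t] by (simp add: enthalpy_eq field_simps)
  have "(\<gamma>\<^sup>2 - 1) * (2 * ((\<rho> t * N t) * (\<rho> t * N t * H t)))
      = (\<gamma> + 1) * (\<rho> t * (N t)\<^sup>2) * (2 * (\<gamma> - 1) * (\<rho> t * H t))"
    by (simp add: algebra_simps power2_eq_square)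
  then have energy: "(\<gamma>\<^sup>2 - 1) * (2 * ((\<rho> t * N t) * (\<rho> t * N t * H t)))
      = (\<gamma> + 1) * (\<rho> t * (N t)\<^sup>2) * ((\<gamma> - 1) * \<rho> t * ((N t)\<^sup>2 + (L t)\<^sup>2) + 2 * \<gamma> * p t)"
    unfolding h .
  show ?thesis
    unfolding right_diff_distrib energy by (simp add: algebra_simps power2_eq_square)
qed

lemma closed_sonic: "closed sonic"
proof -
  have "sonic = {t. (\<gamma> * p t - \<rho> t * (N t)\<^sup>2)\<^sup>2 = 0}"
    by (auto simp: sonic_def)
  also have "closed \<dots>"
    unfolding sonic_discriminant by (intro closed_Collect_eq continuous_intros continuous_on_fluxes)
  finally show ?thesis .
qed

text \<open>
  Off the sonic set \<open>\<gamma> p - \<rho> N\<^sup>2\<close> is a nonzero root of the differentiable discriminant, so it is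
  differentiable, and every primitive variable is a rational function of it and of the fluxes. The balance
  laws are then linear equations for \<open>\<rho>'\<close>, \<open>p'\<close> and \<open>N' - L\<close>, homogeneous and, as
  \<open>N \<noteq> 0\<close>, with a determinant that vanishes only at sonic angles.
\<close>

lemma derivatives_off_sonic:
  assumes "open T" "convex T" and U: "continuous_on T U" and N: "\<And>s. s \<in> T \<Longrightarrow> N s \<noteq> 0"
    and "t \<in> T" "t \<notin> sonic"
  shows "(\<rho> has_real_derivative 0) (at t)" "(p has_real_derivative 0) (at t)"
    "(N has_real_derivative L t) (at t)" "(L has_real_derivative - N t) (at t)"
proof -
  have at: "at t within T = at t"
    using \<open>open T\<close> \<open>t \<in> T\<close> by (rule at_within_open[rotated])
  have contU: "continuous (at t within T) U"
    using U \<open>t \<in> T\<close> by (simp add: continuous_on_eq_continuous_within)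
  note dmass = mass_balance[OF \<open>convex T\<close> \<open>t \<in> T\<close> contU, unfolded at]
  note dtang = tangential_balance[OF \<open>convex T\<close> \<open>t \<in> T\<close> contU, unfolded at]
  note dnorm = normal_balance[OF \<open>convex T\<close> \<open>t \<in> T\<close> contU, unfolded at]
  note dener = energy_balance[OF \<open>convex T\<close> \<open>t \<in> T\<close> contU, unfolded at]
  show dL: "(L has_real_derivative - N t) (at t)"
    using tangential_vel_has_derivative[OF \<open>convex T\<close> \<open>t \<in> T\<close> contU N] unfolding at .
  have Nt: "N t \<noteq> 0" and rt: "\<rho> t > 0"
    using N \<open>t \<in> T\<close> density_pos by auto
  define w where "w s = \<gamma> * p s - \<rho> s * (N s)\<^sup>2" for s
  have "w t \<noteq> 0"
    using \<open>t \<notin> sonic\<close> by (simp add: w_def sonic_def)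
  have "isCont w t"
    unfolding w_def[abs_def]
    by (intro continuous_intros continuous_primitive[OF contU, unfolded at])
  moreover have "\<exists>d. ((\<lambda>s. (w s)\<^sup>2) has_real_derivative d) (at t)"
    unfolding w_def sonic_discriminant
    by (rule exI, rule DERIV_add[OF DERIV_cmult[OF DERIV_power[OF dnorm]]
          DERIV_cmult[OF DERIV_diff[OF DERIV_power[OF dtang] DERIV_cmult[OF DERIV_mult[OF dmass dener]]]]])
  ultimately obtain w' where dw: "(w has_real_derivative w') (at t)"
    using has_real_derivative_of_square \<open>w t \<noteq> 0\<close> by blast
  have "\<exists>d. ((\<lambda>s. (\<gamma> * (\<rho> s * (N s)\<^sup>2 + p s) - w s) / (\<gamma> + 1) / (\<rho> s * N s)) has_real_derivative d) (at t)"
    by (rule exI, rule DERIV_divide[OF DERIV_cdivide[OF DERIV_diff[OF DERIV_cmult[OF dnorm] dw]] dmass])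
       (use Nt rt in simp)
  moreover have "(\<gamma> * (\<rho> s * (N s)\<^sup>2 + p s) - w s) / (\<gamma> + 1) / (\<rho> s * N s) = N s" if "s \<in> T" for s
  proof -
    have "\<gamma> * (\<rho> s * (N s)\<^sup>2 + p s) - w s = N s * (\<gamma> + 1) * (\<rho> s * N s)"
      by (simp add: w_def algebra_simps power2_eq_square)
    then show ?thesis
      using N[OF that] density_pos[of s] gamma by simp
  qed
  ultimately obtain N' where dN: "(N has_real_derivative N') (at t)"
    using has_field_derivative_transform_within_open[OF _ \<open>open T\<close> \<open>t \<in> T\<close>] by blast
  obtain \<rho>' where "((\<lambda>s. (\<rho> s * N s) / N s) has_real_derivative \<rho>') (at t)"
    using DERIV_divide[OF dmass dN Nt] by blast
  then have dr: "(\<rho> has_real_derivative \<rho>') (at t)"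
    by (rule has_field_derivative_transform_within_open[OF _ \<open>open T\<close> \<open>t \<in> T\<close>]) (use N in simp)
  have "((\<lambda>s. (\<rho> s * (N s)\<^sup>2 + p s) - (\<rho> s * N s) * N s) has_real_derivative
      2 * \<rho> t * N t * L t - (\<rho> t * L t * N t + N' * (\<rho> t * N t))) (at t)"
    by (rule DERIV_diff[OF dnorm DERIV_mult[OF dmass dN]])
  moreover have "(\<rho> s * (N s)\<^sup>2 + p s) - (\<rho> s * N s) * N s = p s" for s
    by (simp add: power2_eq_square)
  ultimately have dp: "(p has_real_derivative 2 * \<rho> t * N t * L t - (\<rho> t * L t * N t + N' * (\<rho> t * N t))) (at t)"
    by simp
  define p' where "p' = - (\<rho> t * N t * (N' - L t))"
  have dp: "(p has_real_derivative p') (at t)"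
    by (rule DERIV_cong[OF dp]) (simp add: p'_def algebra_simps)
  have \<rho>': "\<rho>' * N t = - (\<rho> t * (N' - L t))"
    using DERIV_unique[OF DERIV_mult[OF dr dN] dmass] by (simp add: algebra_simps)
  \<comment> \<open>The enthalpy is constant: the energy flux is the mass flux times \<open>H\<close>, and the source of energy is that of mass times \<open>H\<close>.\<close>
  define h' where "h' = (2 * N t * N' + 2 * L t * (- N t)) / 2 + \<gamma> / (\<gamma> - 1) * ((p' * \<rho> t - p t * \<rho>') / (\<rho> t * \<rho> t))"
  have dH: "(H has_real_derivative h') (at t)"
    unfolding enthalpy_eq[abs_def]
    by (rule DERIV_cong[OF DERIV_add[OF DERIV_cdivide[OF DERIV_add[OF DERIV_power[OF dN, of 2] DERIV_power[OF dL, of 2]], of 2]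
          DERIV_cmult[OF DERIV_divide[OF dp dr], of "\<gamma> / (\<gamma> - 1)"]]])
       (use rt in \<open>simp_all add: h'_def mult.assoc mult.left_commute\<close>)
  have "h' = 0"
    using DERIV_unique[OF DERIV_mult[OF dmass dH] dener] Nt rt by simp
  moreover have "(\<gamma> - 1) * (\<rho> t)\<^sup>2 * N t * h' = \<rho> t * (N' - L t) * (\<gamma> * p t - \<rho> t * (N t)\<^sup>2)"
  proof -
    have "(\<gamma> - 1) * (\<rho> t)\<^sup>2 * N t * h' =
        (\<gamma> - 1) * (\<rho> t)\<^sup>2 * (N t)\<^sup>2 * (N' - L t) + \<gamma> * (p' * \<rho> t * N t - p t * (\<rho>' * N t))"
      using rt gamma by (simp add: h'_def field_simps power2_eq_square)
    also have "\<dots> = \<rho> t * (N' - L t) * (\<gamma> * p t - \<rho> t * (N t)\<^sup>2)"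
      unfolding \<rho>' p'_def by (simp add: algebra_simps power2_eq_square)
    finally show ?thesis .
  qed
  ultimately have "N' = L t"
    using \<open>w t \<noteq> 0\<close> rt by (simp add: w_def)
  then show "(N has_real_derivative L t) (at t)" "(p has_real_derivative 0) (at t)" "(\<rho> has_real_derivative 0) (at t)"
    using dN dp dr \<rho>' Nt by (simp_all add: p'_def)
qed

lemma state_eqI:
  assumes "\<rho> s = \<rho> t" "p s = p t" "vel_x (U s) = vel_x (U t)" "vel_y (U s) = vel_y (U t)"
  shows "U s = U t"
proof -
  have nz: "U s $ 1 \<noteq> 0" "U s $ 1 = U t $ 1"
    using density_pos[of s] assms(1) by (simp_all add: density_def)
  have "int_energy (U s) = int_energy (U t)"
    using assms(1,2) density_pos[of t] gamma by (simp add: pressure_def)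
  then have "U s $ 4 = U t $ 4"
    using assms nz by (simp add: int_energy_def energy_def density_def)
  moreover have "U s $ 2 = U t $ 2" "U s $ 3 = U t $ 3"
    using assms(3,4) nz by (simp_all add: vel_x_def vel_y_def)
  ultimately show ?thesis
    using nz by (simp add: vec_eq_iff forall_4)
qed

text \<open>
  The relations \<open>N' = L\<close> and \<open>L' = - N\<close> are those of a fixed vector seen from a rotating frame,
  so the Cartesian velocity is constant.
\<close>

lemma constant_off_sonic:
  assumes "open T" "convex T" "continuous_on T U" "\<And>s. s \<in> T \<Longrightarrow> N s \<noteq> 0"
    and "x < y" "{x..y} \<subseteq> T" "{x<..<y} \<inter> sonic = {}"
  shows "U x = U y"
proof -
  have in_T: "t \<in> T" "t \<notin> sonic" if "x < t" "t < y" for t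
    using that assms(6,7) by auto
  note deriv = derivatives_off_sonic[OF assms(1-4)]
  have contU: "continuous (at t within {x..y}) U" if "t \<in> {x..y}" for t
    using continuous_on_subset[OF assms(3,6)] that by (simp add: continuous_on_eq_continuous_within)
  have cont: "continuous_on {x..y} \<rho>" "continuous_on {x..y} p"
    "continuous_on {x..y} (\<lambda>s. vel_x (U s))" "continuous_on {x..y} (\<lambda>s. vel_y (U s))"
    unfolding continuous_on_eq_continuous_within using continuous_primitive[OF contU] by blast+
  have vel: "((\<lambda>s. vel_x (U s)) has_real_derivative 0) (at t)" "((\<lambda>s. vel_y (U s)) has_real_derivative 0) (at t)"
    if t: "x < t" "t < y" for t
    unfolding vel_x_eq vel_y_eq
    by (rule DERIV_cong[OF DERIV_add[OF DERIV_mult[OF deriv(3) DERIV_sin] DERIV_mult[OF deriv(4) DERIV_cos]]]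
        DERIV_cong[OF DERIV_diff[OF DERIV_mult[OF deriv(4) DERIV_sin] DERIV_mult[OF deriv(3) DERIV_cos]]],
        use in_T[OF t] in simp_all)+
  have "U y = U x"
    using DERIV_isconst_end[OF \<open>x < y\<close> cont(1) deriv(1)] DERIV_isconst_end[OF \<open>x < y\<close> cont(2) deriv(2)]
      DERIV_isconst_end[OF \<open>x < y\<close> cont(3) vel(1)] DERIV_isconst_end[OF \<open>x < y\<close> cont(4) vel(2)] in_T
    by (intro state_eqI) blast+
  then show ?thesis ..
qed

text \<open>
  Across a gap in the sonic set the state is constant, so \<open>N\<^sup>2 = \<gamma> p / \<rho>\<close> would take the same value at both
  ends, although its derivative there is \<open>2 N L\<close>.
\<close>

lemma sonic_convex:
  assumes T: "open T" "convex T" "continuous_on T U" "\<And>s. s \<in> T \<Longrightarrow> N s \<noteq> 0" "\<And>s. s \<in> T \<Longrightarrow> L s \<noteq> 0"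
    and xy: "{x..y} \<subseteq> T" "x \<in> sonic" "y \<in> sonic"
  shows "{x..y} \<subseteq> sonic"
proof
  fix z
  assume z: "z \<in> {x..y}"
  show "z \<in> sonic"
  proof (rule ccontr)
    assume "z \<notin> sonic"
    have compact: "compact (sonic \<inter> {r..s})" for r s
      by (intro closed_Int_compact closed_sonic) simp
    obtain l where l: "l \<in> sonic \<inter> {x..z}" "\<And>t. t \<in> sonic \<inter> {x..z} \<Longrightarrow> t \<le> l"
      using compact_attains_sup[OF compact[of x z]] xy z by force
    obtain r where r: "r \<in> sonic \<inter> {z..y}" "\<And>t. t \<in> sonic \<inter> {z..y} \<Longrightarrow> r \<le> t"
      using compact_attains_inf[OF compact[of z y]] xy z by force
    have "l < r"
      using l(1) r(1) \<open>z \<notin> sonic\<close> by (cases "l = z") auto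
    have gap: "{l<..<r} \<inter> sonic = {}"
      using l r by force
    have lr: "{l..r} \<subseteq> T"
      using l(1) r(1) xy(1) by auto
    have "U l = U r"
      by (rule constant_off_sonic[OF T(1-4) \<open>l < r\<close> lr gap])
    moreover have "(N t)\<^sup>2 = \<gamma> * p t / \<rho> t" if "t \<in> sonic" for t
      using that density_pos[of t] by (simp add: sonic_def field_simps)
    ultimately have "(N l)\<^sup>2 = (N r)\<^sup>2"
      using l(1) r(1) by simp
    moreover have "continuous_on {l..r} (\<lambda>s. (N s)\<^sup>2)"
      unfolding continuous_on_eq_continuous_within
      using continuous_on_subset[OF T(3) lr]
      by (intro ballI continuous_power continuous_primitive) (simp add: continuous_on_eq_continuous_within)
    moreover have deriv: "((\<lambda>s. (N s)\<^sup>2) has_real_derivative 2 * N t * L t) (at t)" if t: "l < t" "t < r" for t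
    proof -
      have "t \<in> T" "t \<notin> sonic"
        using t lr gap by auto
      then show ?thesis
        by (intro DERIV_cong[OF DERIV_power[OF derivatives_off_sonic(3)[OF T(1-4)], of t 2]]) simp_all
    qed
    ultimately obtain t where t: "l < t" "t < r" "((\<lambda>s. (N s)\<^sup>2) has_real_derivative 0) (at t)"
      using Rolle[OF \<open>l < r\<close>] by (metis real_differentiable_def)
    then have "2 * N t * L t = 0"
      using deriv DERIV_unique by blast
    then show False
      using T(4,5)[of t] subsetD[OF lr, of t] t by simp
  qed
qed

text \<open>
  The ends of the sonic interval may be ends of \<open>{a<..<b}\<close>, where \<open>U\<close> is not assumed
  continuous; they are sonic because the sonic set is closed.
\<close>

lemma constant_or_single_sonic_interval:
  assumes B: "continuous_on {a<..<b} U" "\<And>s. s \<in> {a<..<b} \<Longrightarrow> N s \<noteq> 0" "\<And>s. s \<in> {a<..<b} \<Longrightarrow> L s \<noteq> 0"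
  shows "U constant_on {a<..<b} \<or>
    (\<exists>\<alpha> \<beta>. \<alpha> < \<beta> \<and> {\<alpha>..\<beta>} \<subseteq> sonic \<inter> {a..b} \<and> {\<alpha>..\<beta>} \<inter> {a<..<b} \<noteq> {} \<and>
       U constant_on {t \<in> {a<..<b}. t < \<alpha>} \<and> U constant_on {t \<in> {a<..<b}. t > \<beta>})"
proof -
  have open_convex: "open {a<..<b}" "convex {a<..<b}"
    by simp_all
  have const_eq: "U s = U t" if "s \<in> {a<..<b}" "t \<in> {a<..<b}" "s < t" "{s<..<t} \<inter> sonic = {}" for s t
    using that by (intro constant_off_sonic[OF open_convex B(1,2)]) auto
  have constant_onI: "U constant_on A" if "\<And>s t. s \<in> A \<Longrightarrow> t \<in> A \<Longrightarrow> s < t \<Longrightarrow> U s = U t" for A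
    unfolding constant_on_def using that by (metis linorder_neqE_linordered_idom)
  define Z where "Z = sonic \<inter> {a<..<b}"
  show ?thesis
  proof (cases "\<exists>x\<in>Z. \<exists>y\<in>Z. x < y")
    case False
    have "U constant_on {a<..<b}"
    proof (rule constant_onI)
      fix s t
      assume st: "s \<in> {a<..<b}" "t \<in> {a<..<b}" "s < t"
      show "U s = U t"
      proof (cases "{s<..<t} \<inter> sonic = {}")
        case True
        then show ?thesis
          using const_eq st by blast
      next
        \<comment> \<open>A lone sonic point does not interrupt the constancy.\<close>
        case not_empty: False
        then obtain z where z: "z \<in> sonic" "s < z" "z < t"
          by auto
        have only_z: "x \<notin> sonic" if "s < x" "x < t" "x < z \<or> z < x" for x
        proof
          assume "x \<in> sonic"
          with that z st have "x \<in> Z" "z \<in> Z"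
            by (auto simp: Z_def)
          with False that(3) show False
            by blast
        qed
        have gaps: "{s<..<z} \<inter> sonic = {}" "{z<..<t} \<inter> sonic = {}"
          using only_z z(2,3) by (meson IntE disjoint_iff greaterThanLessThan_iff less_trans)+
        have "U s = U z"
          by (rule const_eq[OF _ _ z(2) gaps(1)]) (use st z in auto)
        also have "U z = U t"
          by (rule const_eq[OF _ _ z(3) gaps(2)]) (use st z in auto)
        finally show ?thesis .
      qed
    qed
    then show ?thesis ..
  next
    case True
    then obtain x y where xy: "x \<in> Z" "y \<in> Z" "x < y"
      by blast
    have bdd: "bdd_below Z" "bdd_above Z"
      by (auto simp: Z_def)
    define \<alpha> \<beta> where "\<alpha> = Inf Z" and "\<beta> = Sup Z"
    have between: "\<alpha> \<le> z" "z \<le> \<beta>" if "z \<in> Z" for z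
      using that bdd by (auto simp: \<alpha>_def \<beta>_def intro: cInf_lower cSup_upper)
    have less: "\<alpha> < \<beta>"
      using between[OF xy(1)] between[OF xy(2)] xy(3) by simp
    have ab: "a \<le> \<alpha>" "\<beta> \<le> b"
      unfolding \<alpha>_def \<beta>_def using xy(1) by (auto simp: Z_def intro!: cInf_greatest cSup_least)
    have "{\<alpha><..<\<beta>} \<subseteq> sonic"
    proof
      fix z
      assume z: "z \<in> {\<alpha><..<\<beta>}"
      obtain l where l: "l \<in> Z" "l < z"
        using z xy(1) bdd(1) cInf_lessD[of Z z] by (auto simp: \<alpha>_def)
      obtain r where r: "r \<in> Z" "z < r"
        using z xy(1) bdd(2) less_cSupD[of Z z] by (auto simp: \<beta>_def)
      have "{l..r} \<subseteq> sonic"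
        using l r by (intro sonic_convex[OF open_convex B]) (auto simp: Z_def)
      then show "z \<in> sonic"
        using l r by auto
    qed
    then have "{\<alpha>..\<beta>} \<subseteq> sonic"
      using closure_minimal[OF _ closed_sonic] closure_greaterThanLessThan[OF less] by metis
    moreover have "x \<in> {\<alpha>..\<beta>} \<inter> {a<..<b}"
      using xy(1) between[OF xy(1)] by (auto simp: Z_def)
    then have "{\<alpha>..\<beta>} \<inter> {a<..<b} \<noteq> {}"
      by blast
    moreover have gap: "{s<..<t} \<inter> sonic = {}" if "s \<in> {a<..<b}" "t \<in> {a<..<b}" "t < \<alpha> \<or> \<beta> < s" for s t
    proof -
      have "z \<notin> sonic" if "s < z" "z < t" for z
        using between[of z] that \<open>s \<in> {a<..<b}\<close> \<open>t \<in> {a<..<b}\<close> \<open>t < \<alpha> \<or> \<beta> < s\<close>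
        unfolding Z_def by force
      then show ?thesis
        by auto
    qed
    have "U constant_on {t \<in> {a<..<b}. t < \<alpha>}" "U constant_on {t \<in> {a<..<b}. t > \<beta>}"
      by (rule constant_onI, rule const_eq, simp_all add: gap)+
    moreover have "{\<alpha>..\<beta>} \<subseteq> {a..b}"
      using ab by auto
    ultimately show ?thesis
      using less by blast
  qed
qed

end

section \<open>Sectors\<close>

text \<open>
  The last sector reaches beyond \<open>2 * pi\<close>; there a zero is moved back by one period, where it would
  precede \<open>\<theta> 1\<close>.
\<close>

lemma sector_interior_normal_vel_nonzero:
  assumes periodic: "\<And>t. U (t + 2 * pi) = U t"
    and sectors: "sector_endpoints U m \<theta>" and i: "i \<in> {1..m}"
    and t: "t \<in> {\<theta> i<..<\<theta> (i + 1)}"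
  shows "normal_vel U t \<noteq> 0"
proof
  assume zero: "normal_vel U t = 0"
  have mono: "strict_mono_on {1..m} \<theta>"
    and zeros: "\<theta> ` {1..m} = {t \<in> {0..<2 * pi}. normal_vel U t = 0}"
    and wrap: "\<theta> (m + 1) = \<theta> 1 + 2 * pi"
    using sectors by (auto simp: sector_endpoints_def)
  have le: "\<theta> j \<le> \<theta> k" if "j \<in> {1..m}" "k \<in> {1..m}" "j \<le> k" for j k
    using mono that by (simp add: strict_mono_on_leD)
  have range: "0 \<le> \<theta> j" "\<theta> j < 2 * pi" if "j \<in> {1..m}" for j
    using zeros that by auto
  have "0 \<le> t"
    using range(1)[OF i] t by simp
  show False
  proof (cases "t < 2 * pi")
    case True
    then have "t \<in> \<theta> ` {1..m}"
      unfolding zeros using \<open>0 \<le> t\<close> zero by simp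
    then obtain j where j: "j \<in> {1..m}" "t = \<theta> j"
      by blast
    then show False
      using le[OF j(1) i] le[of "i + 1" j] i t by (cases "j \<le> i") auto
  next
    case False
    have "i = m"
    proof (rule ccontr)
      assume "i \<noteq> m"
      then show False
        using range(2)[of "i + 1"] i t False by simp
    qed
    have "U t = U (t - 2 * pi)"
      using periodic[of "t - 2 * pi"] by simp
    then have "normal_vel U (t - 2 * pi) = normal_vel U t"
      using sin_periodic[of "t - 2 * pi"] cos_periodic[of "t - 2 * pi"] by (simp add: normal_vel_def)
    then have "t - 2 * pi \<in> \<theta> ` {1..m}"
      unfolding zeros using zero False t wrap \<open>i = m\<close> range(2)[of 1] i by simp
    then obtain j where j: "j \<in> {1..m}" "t - 2 * pi = \<theta> j"
      by blast
    then show False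
      using le[of 1 j] t wrap \<open>i = m\<close> by simp
  qed
qed

theorem theorem7:
  fixes \<gamma> cv S0 K :: real and U :: "real \<Rightarrow> state"
    and m i :: nat and \<theta> :: "nat \<Rightarrow> real" and tb :: real
  assumes "\<gamma> > 1" and "cv > 0" and "K > 1"
    and "steady_self_similar_entropy_solution \<gamma> cv S0 K U"
    and "no_stagnation_points U"
    and "right_continuous U"
    and "sector_endpoints U m \<theta>" and "i \<in> {1..m}"
    and "tb \<in> {\<theta> i<..<\<theta> (i + 1)}" and "tangential_vel U tb = 0"
  shows
    "(forward_sector U (\<theta> i) (\<theta> (i + 1)) \<longrightarrow>
      (\<forall>a b. a < b \<and> {a<..<b} \<subseteq> {tb<..<\<theta> (i + 1)} \<and> continuous_on {a<..<b} U \<longrightarrow>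
        U constant_on {a<..<b} \<or>
        (\<exists>\<alpha> \<beta>. forward_compression_wave \<gamma> U (\<theta> i) (\<theta> (i + 1)) tb \<alpha> \<beta> \<and>
           {\<alpha>..\<beta>} \<inter> {a<..<b} \<noteq> {} \<and>
           U constant_on {t \<in> {a<..<b}. t < \<alpha>} \<and>
           U constant_on {t \<in> {a<..<b}. t > \<beta>}))) \<and>
     (backward_sector U (\<theta> i) (\<theta> (i + 1)) \<longrightarrow>
      (\<forall>a b. a < b \<and> {a<..<b} \<subseteq> {\<theta> i<..<tb} \<and> continuous_on {a<..<b} U \<longrightarrow>
        U constant_on {a<..<b} \<or>
        (\<exists>\<alpha> \<beta>. backward_compression_wave \<gamma> U (\<theta> i) (\<theta> (i + 1)) tb \<alpha> \<beta> \<and>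
           {\<alpha>..\<beta>} \<inter> {a<..<b} \<noteq> {} \<and>
           U constant_on {t \<in> {a<..<b}. t < \<alpha>} \<and>
           U constant_on {t \<in> {a<..<b}. t > \<beta>})))"
proof -
  note solution = assms(4)[unfolded steady_self_similar_entropy_solution_def]
  interpret self_similar_flow \<gamma> K U
    using solution \<open>\<gamma> > 1\<close> \<open>K > 1\<close> by unfold_locales blast+
  define l r where "l = \<theta> i" and "r = \<theta> (i + 1)"
  have tb: "l < tb" "tb < r"
    using assms(9) by (simp_all add: l_def r_def)
  have nonzero: "N t \<noteq> 0" if "t \<in> {l<..<r}" for t
    using sector_interior_normal_vel_nonzero[OF _ assms(7,8)] solution that by (simp add: l_def r_def)
  have right: "continuous (at_right t) U" for t
    using assms(6) by (simp add: right_continuous_def)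
  have sonic_nonzero: "N t \<noteq> 0" if "t \<in> sonic" for t
    using that pressure_pos[of t] gamma by (auto simp: sonic_def)
  \<comment> \<open>The wave is closed and may contain an end of the open interval, so the signs of \<open>N\<close> and \<open>L\<close> are needed at sonic ends too.\<close>
  have forward: "U constant_on {a<..<b} \<or>
        (\<exists>\<alpha> \<beta>. forward_compression_wave \<gamma> U l r tb \<alpha> \<beta> \<and> {\<alpha>..\<beta>} \<inter> {a<..<b} \<noteq> {} \<and>
           U constant_on {t \<in> {a<..<b}. t < \<alpha>} \<and> U constant_on {t \<in> {a<..<b}. t > \<beta>})"
    if sector: "forward_sector U l r" and B: "a < b" "{a<..<b} \<subseteq> {tb<..<r}" "continuous_on {a<..<b} U" for a b
  proof -
    have ab: "tb \<le> a" "b \<le> r"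
      using B(1,2) by (simp_all add: greaterThanLessThan_subseteq_greaterThanLessThan)
    have N_pos: "0 < N t" if "t \<in> {tb..r}" "t \<in> sonic \<or> t < r" for t
      using sector that tb nonzero[of t] sonic_nonzero[of t] unfolding forward_sector_def
      by (metis atLeastAtMost_iff greaterThanLessThan_iff less_le less_le_trans)
    have L_neg: "L t < 0" if t: "t \<in> {tb<..r}" "t \<in> sonic \<or> t < r" for t
    proof -
      have "0 < N s" if "s \<in> {tb..t}" for s
        using N_pos[of s] that t by (cases "s = t") auto
      then have "L t < L tb"
        using t by (intro tangential_vel_strict_mono(1)[OF _ _ right]) (auto simp: less_imp_neq[symmetric])
      then show ?thesis
        using assms(10) by simp
    qed
    have NB: "N s \<noteq> 0" and LB: "L s \<noteq> 0" if "s \<in> {a<..<b}" for s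
      using N_pos[of s] L_neg[of s] that ab by auto
    consider "U constant_on {a<..<b}" | \<alpha> \<beta> where "\<alpha> < \<beta>" "{\<alpha>..\<beta>} \<subseteq> sonic \<inter> {a..b}" "{\<alpha>..\<beta>} \<inter> {a<..<b} \<noteq> {}"
      "U constant_on {t \<in> {a<..<b}. t < \<alpha>}" "U constant_on {t \<in> {a<..<b}. t > \<beta>}"
      using constant_or_single_sonic_interval[OF B(3)] NB LB by blast
    then show ?thesis
    proof cases
      case wave: (2 \<alpha> \<beta>)
      have on_wave: "t \<in> sonic" "t \<in> {tb..r}" if "t \<in> {\<alpha>..\<beta>}" for t
        using wave(2) that ab by force+
      have "N t = sound_speed \<gamma> (U t)" if "t \<in> {\<alpha>..\<beta>}" for t
        using on_wave[OF that] N_pos[of t] by (simp add: sonic_iff)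
      moreover have "L t \<le> 0" if "t \<in> {\<alpha>..\<beta>}" for t
        using on_wave[OF that] L_neg[of t] assms(10) by (cases "t = tb") auto
      moreover have "{\<alpha>..\<beta>} \<subseteq> {l..r}" "tb \<le> \<alpha>"
        using on_wave tb wave(1) by force+
      ultimately have "forward_compression_wave \<gamma> U l r tb \<alpha> \<beta>"
        using wave(1) by (simp add: forward_compression_wave_def forward_Prandtl_Meyer_wave_def)
      with wave show ?thesis
        by blast
    qed blast
  qed
  have backward: "U constant_on {a<..<b} \<or>
        (\<exists>\<alpha> \<beta>. backward_compression_wave \<gamma> U l r tb \<alpha> \<beta> \<and> {\<alpha>..\<beta>} \<inter> {a<..<b} \<noteq> {} \<and>
           U constant_on {t \<in> {a<..<b}. t < \<alpha>} \<and> U constant_on {t \<in> {a<..<b}. t > \<beta>})"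
    if sector: "backward_sector U l r" and B: "a < b" "{a<..<b} \<subseteq> {l<..<tb}" "continuous_on {a<..<b} U" for a b
  proof -
    have ab: "l \<le> a" "b \<le> tb"
      using B(1,2) by (simp_all add: greaterThanLessThan_subseteq_greaterThanLessThan)
    have N_neg: "N t < 0" if "t \<in> {l..tb}" "t \<in> sonic \<or> l < t" for t
      using sector that tb nonzero[of t] sonic_nonzero[of t] unfolding backward_sector_def
      by (metis atLeastAtMost_iff greaterThanLessThan_iff less_le le_less_trans)
    have L_neg: "L t < 0" if t: "t \<in> {l..<tb}" "t \<in> sonic \<or> l < t" for t
    proof -
      have "N s < 0" if "s \<in> {t..tb}" for s
        using N_neg[of s] that t by (cases "s = t") auto
      then have "L t < L tb"
        using t by (intro tangential_vel_strict_mono(2)[OF _ _ right]) (auto simp: less_imp_neq)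
      then show ?thesis
        using assms(10) by simp
    qed
    have NB: "N s \<noteq> 0" and LB: "L s \<noteq> 0" if "s \<in> {a<..<b}" for s
      using N_neg[of s] L_neg[of s] that ab by auto
    consider "U constant_on {a<..<b}" | \<alpha> \<beta> where "\<alpha> < \<beta>" "{\<alpha>..\<beta>} \<subseteq> sonic \<inter> {a..b}" "{\<alpha>..\<beta>} \<inter> {a<..<b} \<noteq> {}"
      "U constant_on {t \<in> {a<..<b}. t < \<alpha>}" "U constant_on {t \<in> {a<..<b}. t > \<beta>}"
      using constant_or_single_sonic_interval[OF B(3)] NB LB by blast
    then show ?thesis
    proof cases
      case wave: (2 \<alpha> \<beta>)
      have on_wave: "t \<in> sonic" "t \<in> {l..tb}" if "t \<in> {\<alpha>..\<beta>}" for t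
        using wave(2) that ab by force+
      have "N t = - sound_speed \<gamma> (U t)" if "t \<in> {\<alpha>..\<beta>}" for t
        using on_wave[OF that] N_neg[of t] by (simp add: sonic_iff)
      moreover have "L t \<le> 0" if "t \<in> {\<alpha>..\<beta>}" for t
        using on_wave[OF that] L_neg[of t] assms(10) by (cases "t = tb") auto
      moreover have "{\<alpha>..\<beta>} \<subseteq> {l..r}" "\<beta> \<le> tb"
        using on_wave tb wave(1) by force+
      ultimately have "backward_compression_wave \<gamma> U l r tb \<alpha> \<beta>"
        using wave(1) by (simp add: backward_compression_wave_def backward_Prandtl_Meyer_wave_def)
      with wave show ?thesis
        by blast
    qed blast
  qed
  show ?thesis
    using forward backward unfolding l_def r_def by blast
qed

end
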